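(* For every integer $N\ge 0$ the families $S_{2N}(\lambda+n-1-2N)$ and $D_{2N}^{\mathrm{nc}}(\lambda)$ of operators $C^\infty(\mathbb{R}^n)\to C^\infty(\mathbb{R}^{n-1})$ coincide, up to a rational function in $\lambda$; that is, there is a nonzero rational function $r_N(\lambda)$ such that $S_{2N}(\lambda+n-1-2N)=r_N(\lambda)\,D_{2N}^{\mathrm{nc}}(\lambda)$ as rational families in $\lambda$.
   Context: Fix an integer $n\ge 4$. On $\mathbb{R}^n$ write $x=(x',x_n)$, let $(i^*\varphi)(x')=\varphi(x',0)$ and $\Delta_{\mathbb{M}^{n-1}}=-\frac{\partial^2}{\partial x_1^2}+\sum_{i=2}^{n-1}\frac{\partial^2}{\partial x_i^2}$. The family $S_{2N}$: let $\mathbb{U}_n=\{x\in\mathbb{R}^n: x_n>0\}$ with the Lorentzian metric $x_n^{-2}(-dx_1^2+\sum_{i=2}^n dx_i^2)$ and Laplacian $\Delta_{\mathbb{U}_n}=x_n^2\Delta_{\mathbb{M}^{n-1}}+x_n^2\frac{\partial^2}{\partial x_n^2}-(n-2)x_n\frac{\partial}{\partial x_n}$. Formal solutions $u\sim\sum_{j\ge0}x_n^{\lambda+2j}c_{2j}(x')$ of $-\Delta_{\mathbb{U}_n}u=\lambda(n-1-\lambda)u$ have their coefficients $c_{2j}$ determined recursively by $c_0$ (for generic $\lambda$); $T_{2j}(\lambda):C^\infty(\mathbb{R}^{n-1})\to C^\infty(\mathbb{R}^{n-1})$ is the resulting differential operator $c_0\mapsto c_{2j}$, with $T_0=\mathrm{id}$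 (it depends rationally on $\lambda$). Define $S_{2N}(\lambda):C^\infty(\mathbb{R}^n)\to C^\infty(\mathbb{R}^{n-1})$ by $S_{2N}(\lambda)=\sum_{j=0}^N\frac{1}{(2N-2j)!}T_{2j}(\lambda)\,i^*\left(\frac{\partial}{\partial x_n}\right)^{2N-2j}$. The family $D_{2N}^{\mathrm{nc}}$: for $m\in\{n,n+1\}$ let $G^m=O(2,m-1)$ (preserving $-t_1^2-t_2^2+x_1^2+\dots+x_{m-1}^2$, coordinates ordered $(t_1,t_2,x_1,\dots)$), with Lie algebra $\mathfrak{g}_m$. With elementary matrices $E_{ab}$ put $H=E_{14}+E_{41}$, $H_2=E_{23}+E_{32}$, $Q_1^-=-E_{12}+E_{21}+E_{24}+E_{42}$, $Q_2^-=E_{13}+E_{31}+E_{34}-E_{43}$, and for $1\le i,j\le m-3$: $Y_j^-=E_{4+j,1}+E_{4+j,4}+E_{1,4+j}-E_{4,4+j}$, $Z_j^+=E_{2,4+j}+E_{3,4+j}+E_{4+j,2}-E_{4+j,3}$, $M_{ij}=E_{4+i,4+j}-E_{4+j,4+i}$; $Q_i^+,Y_j^+,Z_j^-$ are the transposes of $Q_i^-,Y_j^-,Z_j^+$. Let $A=\exp(\mathbb{R}H)$, $\mathfrak{n}_m^\pm=\mathrm{span}(Q_1^\pm,Q_2^\pm,Y_j^\pm)$ (abelian), $(N^\pm)^m=\exp\mathfrak{n}_m^\pm$, $M_0^m$ the analytic subgroup with Lie algebra $\mathfrak{m}_m=\mathrm{span}(H_2,Z_j^\pm,M_{ij})$,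 $w_1=\mathrm{diag}(1,-1,1,1,\dots,1)$, $w_2=\mathrm{diag}(1,1,-1,1,\dots,1)$, $M^m=\{1,-1\}\langle w_1,w_2\rangle M_0^m$, $P^m=M^mA(N^+)^m$, $\xi_\lambda(\exp tH)=e^{\lambda t}$, and $\mathrm{Ind}_{P^m}^{G^m}(\xi_\lambda)=\{u\in C^\infty(G^m): u(g\tilde m\tilde a\tilde n)=\xi_\lambda(\tilde a)u(g)\ \forall\,\tilde m\tilde a\tilde n\in P^m\}$. $\mathcal{U}(\mathfrak{g}_{n+1})$ acts on $C^\infty(G^{n+1})$ by extending $(R(X)u)(x)=\frac{d}{dt}|_{t=0}u(x\exp tX)$. Embed $G^n\subset G^{n+1}$ by $g\mapsto\begin{pmatrix}g&0\\0&1\end{pmatrix}$. Let $\Delta_{n-1}=-(Q_1^-)^2+(Q_2^-)^2+\sum_{j=1}^{n-3}(Y_j^-)^2$, $T_n=Y_{n-2}^-\in\mathfrak{n}_{n+1}^-$, and $\mathcal{D}_{2N}^0(\lambda)=\sum_{j=0}^N a_j(\lambda)\Delta_{n-1}^jT_n^{2N-2j}\in\mathcal{U}(\mathfrak{n}^-_{n+1})$, where $a_N(\lambda)=1$ and $(N-j+1)(2N-2j+1)a_{j-1}(\lambda)+j(n-1+2\lambda-4N+2j)a_j(\lambda)=0$ for $j=1,\dots,N$. Then $D_{2N}(\lambda):\mathrm{Ind}_{P^{n+1}}^{G^{n+1}}(\xi_\lambda)\to\mathrm{Ind}_{P^n}^{G^n}(\xi_{\lambda-2N})$ is $R(\mathcal{D}^0_{2N}(\lambda))$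 followed by restriction to $G^n$. With $\beta^m$ the (injective) restriction of functions from $G^m$ to $(N^-)^m$, identified with $\mathbb{R}^{m-1}$ by $(x_1,\dots,x_{m-1})\mapsto\exp(x_1Q_1^-+x_2Q_2^-+\sum_{i=3}^{m-1}x_iY_{i-2}^-)$, set $D_{2N}^{\mathrm{nc}}(\lambda)=\beta^n\circ D_{2N}(\lambda)\circ(\beta^{n+1})^{-1}$ on the image of $\beta^{n+1}$ in $C^\infty(\mathbb{R}^n)$. As a differential operator it is $D_{2N}^{\mathrm{nc}}(\lambda)=\sum_{j=0}^N a_j(\lambda)(\Delta_{\mathbb{M}^{n-1}})^j\,i^*\left(\frac{\partial}{\partial x_n}\right)^{2N-2j}$, and by this formula it is regarded as an operator $C^\infty(\mathbb{R}^n)\to C^\infty(\mathbb{R}^{n-1})$. *)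

theory Defs
  imports
    "HOL-Analysis.Analysis"
    "HOL-Algebra.Generated_Groups"
    "HOL-Computational_Algebra.Polynomial"
begin

section \<open>Smooth functions of finitely many real coordinates\<close>

text \<open>
  For a finite index set \<open>I\<close>, a function on \<open>\<real>\<^sup>I\<close> is represented by a function of families
  \<open>x :: 'i \<Rightarrow> real\<close> that depends only on the coordinates \<open>x i\<close> with \<open>i \<in> I\<close>.  With
  \<open>I = {1..k}\<close> this models \<open>\<real>\<^sup>k\<close> with coordinates \<open>x 1, \<dots>, x k\<close>, and functions on \<open>\<real>\<^sup>k\<close> are
  equal iff their representations are.  Functions are complex-valued.
\<close>

definition pd :: "'i \<Rightarrow> (('i \<Rightarrow> real) \<Rightarrow> complex) \<Rightarrow> ('i \<Rightarrow> real) \<Rightarrow> complex" where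
  "pd i f x = vector_derivative (\<lambda>t. f (x(i := t))) (at (x i))"

text \<open>All iterated partial derivatives exist and are continuous.  (Continuity refers to the
  product topology, which for functions of the coordinates in \<open>I\<close> is the topology of \<open>\<real>\<^sup>I\<close>.)\<close>

definition C_infty :: "'i set \<Rightarrow> (('i \<Rightarrow> real) \<Rightarrow> complex) set" where
  "C_infty I = {f.
     (\<forall>x y. (\<forall>i\<in>I. x i = y i) \<longrightarrow> f x = f y) \<and>
     (\<forall>is. set is \<subseteq> I \<longrightarrow>
        continuous_on UNIV (foldr pd is f) \<and>
        (\<forall>i\<in>I. \<forall>x. (\<lambda>t. foldr pd is f (x(i := t))) differentiable (at (x i))))}"

definition istar :: "nat \<Rightarrow> ((nat \<Rightarrow> real) \<Rightarrow> complex) \<Rightarrow> (nat \<Rightarrow> real) \<Rightarrow> complex" where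
  "istar n \<phi> = (\<lambda>x. \<phi> (x(n := 0)))"

text \<open>The Laplacian of the Minkowski space of dimension \<open>n - 1\<close>; \<open>x 1\<close> is the time coordinate.\<close>

definition lapM :: "nat \<Rightarrow> ((nat \<Rightarrow> real) \<Rightarrow> complex) \<Rightarrow> (nat \<Rightarrow> real) \<Rightarrow> complex" where
  "lapM n f = (\<lambda>x. - pd 1 (pd 1 f) x + (\<Sum>i=2..n-1. pd i (pd i f) x))"


section \<open>The family \<open>S\<^sub>2\<^sub>N\<close>\<close>

text \<open>
  A formal series \<open>\<Sum>\<^sub>\<mu> (x n powr \<mu>) f\<^sub>\<mu>(x')\<close> is represented by its coefficient function \<open>\<mu> \<mapsto> f\<^sub>\<mu>\<close>.
\<close>

type_synonym formal = "complex \<Rightarrow> (nat \<Rightarrow> real) \<Rightarrow> complex"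

definition mul_xn :: "formal \<Rightarrow> formal" where
  "mul_xn f = (\<lambda>\<mu>. f (\<mu> - 1))"

definition d_xn :: "formal \<Rightarrow> formal" where
  "d_xn f = (\<lambda>\<mu> x. (\<mu> + 1) * f (\<mu> + 1) x)"

text \<open>Term by term action of
  \<open>\<Delta>\<^sub>U = x\<^sub>n\<^sup>2 \<Delta>\<^sub>M + x\<^sub>n\<^sup>2 \<partial>\<^sub>n\<^sup>2 - (n - 2) x\<^sub>n \<partial>\<^sub>n\<close>.\<close>

definition lapU :: "nat \<Rightarrow> formal \<Rightarrow> formal" where
  "lapU n f = (\<lambda>\<mu> x.
     mul_xn (mul_xn (\<lambda>\<nu>. lapM n (f \<nu>))) \<mu> x
     + mul_xn (mul_xn (d_xn (d_xn f))) \<mu> x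
     - (of_nat n - 2) * mul_xn (d_xn f) \<mu> x)"

text \<open>The series \<open>\<Sum>\<^sub>j (x n powr (lam + 2 j)) c\<^sub>2\<^sub>j(x')\<close>, with \<open>c j\<close> in the role of \<open>c\<^sub>2\<^sub>j\<close>; the index set of
  the sum below has at most one element.\<close>

definition series :: "complex \<Rightarrow> (nat \<Rightarrow> (nat \<Rightarrow> real) \<Rightarrow> complex) \<Rightarrow> formal" where
  "series lam c = (\<lambda>\<mu> x. \<Sum>j\<in>{j. \<mu> = lam + 2 * of_nat j}. c j x)"

text \<open>\<open>formal_solution n lam J c\<close>: the series solves
  \<open>- \<Delta>\<^sub>U u = lam (n - 1 - lam) u\<close> in all orders up to and including \<open>x n powr (lam + 2 J)\<close>.  These are the
  equations that involve only \<open>c 0, \<dots>, c J\<close>; a formal solution satisfies them for all \<open>J\<close>.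
  Working with a finite order keeps the operator of order \<open>2 J\<close> away from the resonances
  of higher order coefficients, so that it is defined at each regular point of the
  rational family.\<close>

definition formal_solution ::
  "nat \<Rightarrow> complex \<Rightarrow> nat \<Rightarrow> (nat \<Rightarrow> (nat \<Rightarrow> real) \<Rightarrow> complex) \<Rightarrow> bool" where
  "formal_solution n lam J c \<longleftrightarrow>
     (\<forall>j\<le>J. c j \<in> C_infty {1..n-1}) \<and>
     (\<forall>j\<le>J. \<forall>x. - lapU n (series lam c) (lam + 2 * of_nat j) x
        = lam * (of_nat n - 1 - lam) * series lam c (lam + 2 * of_nat j) x)"

definition is_coeff ::
  "nat \<Rightarrow> nat \<Rightarrow> complex \<Rightarrow> ((nat \<Rightarrow> real) \<Rightarrow> complex) \<Rightarrow> ((nat \<Rightarrow> real) \<Rightarrow> complex) \<Rightarrow> bool" where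
  "is_coeff n j lam c0 d \<longleftrightarrow> (\<exists>c. formal_solution n lam j c \<and> c 0 = c0 \<and> c j = d)"

definition T_op :: "nat \<Rightarrow> nat \<Rightarrow> complex \<Rightarrow> ((nat \<Rightarrow> real) \<Rightarrow> complex) \<Rightarrow> (nat \<Rightarrow> real) \<Rightarrow> complex" where
  "T_op n j lam c0 = (THE d. is_coeff n j lam c0 d)"

text \<open>The coefficients up to \<open>c\<^sub>2\<^sub>N\<close> exist and are determined by \<open>c\<^sub>0\<close>; for other \<open>lam\<close> the
  value of \<open>S_op n N lam\<close> below is meaningless.\<close>

definition determined :: "nat \<Rightarrow> nat \<Rightarrow> complex \<Rightarrow> bool" where
  "determined n N lam \<longleftrightarrow> (\<forall>j\<le>N. \<forall>c0\<in>C_infty {1..n-1}. \<exists>!d. is_coeff n j lam c0 d)"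

definition S_op :: "nat \<Rightarrow> nat \<Rightarrow> complex \<Rightarrow> ((nat \<Rightarrow> real) \<Rightarrow> complex) \<Rightarrow> (nat \<Rightarrow> real) \<Rightarrow> complex" where
  "S_op n N lam \<phi> = (\<lambda>x. \<Sum>j\<le>N.
     1 / fact (2 * N - 2 * j) * T_op n j lam (istar n ((pd n ^^ (2 * N - 2 * j)) \<phi>)) x)"


section \<open>The family \<open>D\<^sub>2\<^sub>N\<close> in the noncompact model\<close>

function a_coef :: "nat \<Rightarrow> nat \<Rightarrow> complex \<Rightarrow> nat \<Rightarrow> complex" where
  "a_coef n N lam j = (if N \<le> j then 1 else
     - (of_nat (j + 1) * (of_nat n - 1 + 2 * lam - 4 * of_nat N + 2 * of_nat (j + 1)))
       / (of_nat (N - j) * of_nat (2 * N - 2 * j - 1)) * a_coef n N lam (j + 1))"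
  by auto
termination by (relation "Wellfounded.measure (\<lambda>(n, N, lam, j). N - j)") auto

declare a_coef.simps [simp del]

lemma a_coef_top: "a_coef n N lam N = 1"
  by (simp add: a_coef.simps)

lemma a_coef_recurrence:
  assumes "1 \<le> j" "j \<le> N"
  shows "of_nat (N - j + 1) * of_nat (2 * N - 2 * j + 1) * a_coef n N lam (j - 1)
    + of_nat j * (of_nat n - 1 + 2 * lam - 4 * of_nat N + 2 * of_nat j) * a_coef n N lam j = 0"
proof -
  obtain i where i: "j = Suc i" using assms by (cases j) auto
  have e: "N - j + 1 = N - i" "2 * N - 2 * j + 1 = 2 * N - 2 * i - 1" using assms i by auto
  have nz: "of_nat (N - i) \<noteq> (0::complex)" "of_nat (2 * N - 2 * i - 1) \<noteq> (0::complex)"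
    using assms i by (auto simp del: of_nat_diff)
  have "a_coef n N lam i = - (of_nat j * (of_nat n - 1 + 2 * lam - 4 * of_nat N + 2 * of_nat j))
       / (of_nat (N - i) * of_nat (2 * N - 2 * i - 1)) * a_coef n N lam j"
    using assms i by (subst a_coef.simps) (simp del: of_nat_diff)
  hence "of_nat (N - i) * of_nat (2 * N - 2 * i - 1) * a_coef n N lam i
      = - (of_nat j * (of_nat n - 1 + 2 * lam - 4 * of_nat N + 2 * of_nat j)) * a_coef n N lam j"
    using nz by (simp add: field_simps del: of_nat_diff)
  thus ?thesis unfolding e using i by (simp del: of_nat_diff)
qed

definition D_nc :: "nat \<Rightarrow> nat \<Rightarrow> complex \<Rightarrow> ((nat \<Rightarrow> real) \<Rightarrow> complex) \<Rightarrow> (nat \<Rightarrow> real) \<Rightarrow> complex" where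
  "D_nc n N lam \<phi> = (\<lambda>x. \<Sum>j\<le>N.
     a_coef n N lam j * (lapM n ^^ j) (istar n ((pd n ^^ (2 * N - 2 * j)) \<phi>)) x)"


section \<open>The group-theoretic origin of \<open>D_nc\<close>\<close>

text \<open>
  The rest of this theory defines the operators \<open>D\<^sub>2\<^sub>N(lam)\<close> between functions on
  \<open>O(2,n)\<close> and \<open>O(2,n-1)\<close> and shows (theorem \<open>D_nc_beta\<close>) that in the coordinates of the
  opposite unipotent groups they are given by \<open>D_nc\<close>.

  A \<open>k \<times> k\<close> matrix is a function on index pairs that vanishes outside \<open>{1..k} \<times> {1..k}\<close>;
  rows and columns are ordered as \<open>(t\<^sub>1, t\<^sub>2, x\<^sub>1, x\<^sub>2, \<dots>)\<close>.
\<close>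

type_synonym matrix = "nat \<times> nat \<Rightarrow> real"

definition MAT :: "nat \<Rightarrow> matrix monoid" where
  "MAT k = \<lparr>carrier = {A. \<forall>p. p \<notin> {1..k} \<times> {1..k} \<longrightarrow> A p = 0},
     mult = (\<lambda>A B (i, j). \<Sum>l=1..k. A (i, l) * B (l, j)),
     one = (\<lambda>(i, j). if i = j \<and> i \<in> {1..k} then 1 else 0)\<rparr>"

definition GL :: "nat \<Rightarrow> matrix monoid" where
  "GL k = units_of (MAT k)"

definition mexp :: "nat \<Rightarrow> matrix \<Rightarrow> matrix" where
  "mexp k A = (\<lambda>p. \<Sum>i. (A [^]\<^bsub>MAT k\<^esub> (i::nat)) p / fact i)"

definition transp :: "matrix \<Rightarrow> matrix" where
  "transp A = (\<lambda>(i, j). A (j, i))"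

definition mscale :: "real \<Rightarrow> matrix \<Rightarrow> matrix" where
  "mscale t A = (\<lambda>p. t * A p)"

definition mspan :: "matrix set \<Rightarrow> matrix set" where
  "mspan B = {X. \<exists>F c. finite F \<and> F \<subseteq> B \<and> X = (\<lambda>p. \<Sum>Y\<in>F. c Y * Y p)}"

definition Emat :: "nat \<Rightarrow> nat \<Rightarrow> matrix" where
  "Emat i j = (\<lambda>p. if p = (i, j) then 1 else 0)"

definition diagm :: "nat \<Rightarrow> (nat \<Rightarrow> real) \<Rightarrow> matrix" where
  "diagm k d = (\<lambda>(i, j). if i = j \<and> i \<in> {1..k} then d i else 0)"

definition Gr :: "nat \<Rightarrow> matrix set" where
  "Gr m = {g \<in> carrier (MAT (m + 1)).
     transp g \<otimes>\<^bsub>MAT (m + 1)\<^esub> diagm (m + 1) (\<lambda>i. if i \<le> 2 then -1 else 1) \<otimes>\<^bsub>MAT (m + 1)\<^esub> g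
       = diagm (m + 1) (\<lambda>i. if i \<le> 2 then -1 else 1)}"

definition "Hmat = (\<lambda>p. Emat 1 4 p + Emat 4 1 p)"
definition "H2 = (\<lambda>p. Emat 2 3 p + Emat 3 2 p)"
definition "Qminus1 = (\<lambda>p. - Emat 1 2 p + Emat 2 1 p + Emat 2 4 p + Emat 4 2 p)"
definition "Qminus2 = (\<lambda>p. Emat 1 3 p + Emat 3 1 p + Emat 3 4 p - Emat 4 3 p)"
definition "Yminus j = (\<lambda>p. Emat (4 + j) 1 p + Emat (4 + j) 4 p + Emat 1 (4 + j) p - Emat 4 (4 + j) p)"
definition "Zplus j = (\<lambda>p. Emat 2 (4 + j) p + Emat 3 (4 + j) p + Emat (4 + j) 2 p - Emat (4 + j) 3 p)"
definition "Mrot i j = (\<lambda>p. Emat (4 + i) (4 + j) p - Emat (4 + j) (4 + i) p)"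

definition Nplus :: "nat \<Rightarrow> matrix set" where
  "Nplus m = mexp (m + 1) ` mspan
     ({transp Qminus1, transp Qminus2} \<union> (\<lambda>j. transp (Yminus j)) ` {1..m-3})"

definition liem :: "nat \<Rightarrow> matrix set" where
  "liem m = mspan ({H2} \<union> Zplus ` {1..m-3} \<union> (\<lambda>j. transp (Zplus j)) ` {1..m-3}
     \<union> (\<lambda>(i, j). Mrot i j) ` ({1..m-3} \<times> {1..m-3}))"

text \<open>The analytic subgroup is the subgroup generated by the exponentials of its Lie algebra.\<close>

definition M0 :: "nat \<Rightarrow> matrix set" where
  "M0 m = generate (GL (m + 1)) (mexp (m + 1) ` liem m)"

definition Mgr :: "nat \<Rightarrow> matrix set" where
  "Mgr m = {\<one>\<^bsub>GL (m + 1)\<^esub>, mscale (-1) \<one>\<^bsub>GL (m + 1)\<^esub>}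
     <#>\<^bsub>GL (m + 1)\<^esub> generate (GL (m + 1))
          {diagm (m + 1) (\<lambda>i. if i = 2 then -1 else 1), diagm (m + 1) (\<lambda>i. if i = 3 then -1 else 1)}
     <#>\<^bsub>GL (m + 1)\<^esub> M0 m"

text \<open>Only the values of \<open>u\<close> on the group \<open>Gr m\<close> matter.  As \<open>O(2,m-1)\<close> is a closed submanifold of
  the space of matrices, its smooth functions are the restrictions of smooth functions of
  matrices.\<close>

definition Ind :: "nat \<Rightarrow> complex \<Rightarrow> (matrix \<Rightarrow> complex) set" where
  "Ind m lam = {u.
     (\<exists>F\<in>C_infty ({1..m+1} \<times> {1..m+1}). \<forall>g\<in>Gr m. u g = F g) \<and>
     (\<forall>g\<in>Gr m. \<forall>h\<in>Mgr m. \<forall>t. \<forall>\<nu>\<in>Nplus m.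
        u (g \<otimes>\<^bsub>MAT (m + 1)\<^esub> (h \<otimes>\<^bsub>MAT (m + 1)\<^esub> mexp (m + 1) (mscale t Hmat) \<otimes>\<^bsub>MAT (m + 1)\<^esub> \<nu>))
          = exp (lam * of_real t) * u g)}"

definition R_act :: "nat \<Rightarrow> matrix \<Rightarrow> (matrix \<Rightarrow> complex) \<Rightarrow> matrix \<Rightarrow> complex" where
  "R_act m X u = (\<lambda>g. vector_derivative (\<lambda>t. u (g \<otimes>\<^bsub>MAT (m + 1)\<^esub> mexp (m + 1) (mscale t X))) (at 0))"

text \<open>The action of \<open>\<Delta>\<^sub>n\<^sub>-\<^sub>1 = - (Q\<^sub>1\<^sup>-)\<^sup>2 + (Q\<^sub>2\<^sup>-)\<^sup>2 + \<Sum>\<^sub>j (Y\<^sub>j\<^sup>-)\<^sup>2\<close> on functions on \<open>O(2,n)\<close>.\<close>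

definition R_lap :: "nat \<Rightarrow> (matrix \<Rightarrow> complex) \<Rightarrow> matrix \<Rightarrow> complex" where
  "R_lap n u = (\<lambda>g. - R_act (n + 1) Qminus1 (R_act (n + 1) Qminus1 u) g
     + R_act (n + 1) Qminus2 (R_act (n + 1) Qminus2 u) g
     + (\<Sum>j=1..n-3. R_act (n + 1) (Yminus j) (R_act (n + 1) (Yminus j) u) g))"

definition embed :: "nat \<Rightarrow> matrix \<Rightarrow> matrix" where
  "embed n g = (\<lambda>p. if p = (n + 2, n + 2) then 1 else g p)"

text \<open>\<open>R_act\<close> extends to a homomorphism on the enveloping algebra; this is the action of
  \<open>\<Sum>\<^sub>j a\<^sub>j(lam) \<Delta>\<^sub>n\<^sub>-\<^sub>1\<^sup>j (Y\<^sub>n\<^sub>-\<^sub>2\<^sup>-)\<^sup>2\<^sup>N\<^sup>-\<^sup>2\<^sup>j\<close>, followed by restriction.\<close>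

definition D_group :: "nat \<Rightarrow> nat \<Rightarrow> complex \<Rightarrow> (matrix \<Rightarrow> complex) \<Rightarrow> matrix \<Rightarrow> complex" where
  "D_group n N lam u = (\<lambda>g. \<Sum>j\<le>N. a_coef n N lam j *
     (R_lap n ^^ j) ((R_act (n + 1) (Yminus (n - 2)) ^^ (2 * N - 2 * j)) u) (embed n g))"

definition nminus :: "nat \<Rightarrow> (nat \<Rightarrow> real) \<Rightarrow> matrix" where
  "nminus m x = (\<lambda>p. x 1 * Qminus1 p + x 2 * Qminus2 p + (\<Sum>i=3..m-1. x i * Yminus (i - 2) p))"

definition \<beta> :: "nat \<Rightarrow> (matrix \<Rightarrow> complex) \<Rightarrow> (nat \<Rightarrow> real) \<Rightarrow> complex" where
  "\<beta> m u = (\<lambda>x. u (mexp (m + 1) (nminus m x)))"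

subsection \<open>Exponentials of \<open>\<nn>\<^sub>m\<^sup>-\<close>\<close>

definition eps :: "nat \<Rightarrow> real" where "eps c = (if c = 2 then -1 else 1)"
definition pv :: "nat \<Rightarrow> real" where "pv c = (if c = 1 \<or> c = 4 then 1 else 0)"
definition qv :: "nat \<Rightarrow> real" where "qv c = (if c = 1 then 1 else if c = 4 then -1 else 0)"

definition mk :: "(nat \<Rightarrow> real) \<Rightarrow> matrix" where
  "mk v = (\<lambda>(i, j). v i * pv j + qv i * (eps j * v j))"

definition dotp :: "nat \<Rightarrow> (nat \<Rightarrow> real) \<Rightarrow> (nat \<Rightarrow> real) \<Rightarrow> real" where
  "dotp k v w = (\<Sum>c=1..k. eps c * v c * w c)"

definition qp :: "real \<Rightarrow> matrix" where
  "qp s = (\<lambda>(i, j). s * (qv i * pv j))"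

definition adm :: "nat \<Rightarrow> (nat \<Rightarrow> real) \<Rightarrow> bool" where
  "adm k v \<longleftrightarrow> 4 \<le> k \<and> v 1 = 0 \<and> v 4 = 0 \<and> (\<forall>c. c \<notin> {1..k} \<longrightarrow> v c = 0)"

lemma pq_values: "pv 1 = 1" "pv 4 = 1" "qv 1 = 1" "qv 4 = -1"
  by (simp_all add: pv_def qv_def)

lemma sum_pq:
  assumes "4 \<le> k"
  shows "(\<Sum>c=1..k. f c * pv c) = f 1 + f 4" "(\<Sum>c=1..k. f c * qv c) = f 1 - f (4::nat)"
proof -
  have "(\<Sum>c=1..k. f c * pv c) = (\<Sum>c\<in>{1,4}. f c * pv c)"
    by (rule sum.mono_neutral_right) (use assms in \<open>auto simp: pv_def\<close>)
  thus "(\<Sum>c=1..k. f c * pv c) = f 1 + f 4" by (simp add: pv_def)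
  have "(\<Sum>c=1..k. f c * qv c) = (\<Sum>c\<in>{1,4}. f c * qv c)"
    by (rule sum.mono_neutral_right) (use assms in \<open>auto simp: qv_def\<close>)
  thus "(\<Sum>c=1..k. f c * qv c) = f 1 - f 4" by (simp add: qv_def)
qed

lemma mult_MAT: "(A \<otimes>\<^bsub>MAT k\<^esub> B) (i, j) = (\<Sum>l=1..k. A (i, l) * B (l, j))"
  by (simp add: MAT_def)

lemma one_MAT: "\<one>\<^bsub>MAT k\<^esub> (i, j) = (if i = j \<and> i \<in> {1..k} then 1 else 0)"
  by (simp add: MAT_def)

lemma mult_one_left:
  assumes "A \<in> carrier (MAT k)"
  shows "\<one>\<^bsub>MAT k\<^esub> \<otimes>\<^bsub>MAT k\<^esub> A = A"
proof
  fix p :: "nat \<times> nat"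
  obtain i j where p: "p = (i, j)" by (cases p)
  have "(\<Sum>l=1..k. \<one>\<^bsub>MAT k\<^esub> (i, l) * A (l, j)) = (\<Sum>l=1..k. if i = l then A (l, j) else 0)"
    by (rule sum.cong) (auto simp: one_MAT)
  also have "\<dots> = A (i, j)" using assms by (auto simp: MAT_def)
  finally show "(\<one>\<^bsub>MAT k\<^esub> \<otimes>\<^bsub>MAT k\<^esub> A) p = A p" by (simp add: p mult_MAT)
qed

lemma mk_mult:
  assumes "adm k v" "adm k w"
  shows "mk v \<otimes>\<^bsub>MAT k\<^esub> mk w = qp (dotp k v w)"
proof
  fix p :: "nat \<times> nat"
  obtain i j where p: "p = (i, j)" by (cases p)
  have k: "4 \<le> k" using assms by (simp add: adm_def)
  have "(\<Sum>l=1..k. mk v (i, l) * mk w (l, j))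
    = (\<Sum>l=1..k. (v i * pv j * w l) * pv l) + (\<Sum>l=1..k. (v i * (eps j * w j) * qv l) * pv l)
      + (qv i * pv j) * (\<Sum>l=1..k. eps l * v l * w l)
      + (\<Sum>l=1..k. (qv i * (eps l * v l) * (eps j * w j)) * qv l)"
    by (simp add: mk_def sum.distrib [symmetric] sum_distrib_left algebra_simps)
  also have "\<dots> = qp (dotp k v w) p"
    using assms by (simp add: p qp_def dotp_def adm_def sum_pq [OF k] pq_values del: One_nat_def)
  finally show "(mk v \<otimes>\<^bsub>MAT k\<^esub> mk w) p = qp (dotp k v w) p" by (simp add: p mult_MAT)
qed

lemma qp_mult:
  assumes "adm k v"
  shows "qp s \<otimes>\<^bsub>MAT k\<^esub> mk v = (\<lambda>_. 0)" "mk v \<otimes>\<^bsub>MAT k\<^esub> qp s = (\<lambda>_. 0)"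
    and "qp s \<otimes>\<^bsub>MAT k\<^esub> qp t = (\<lambda>_. 0)"
proof -
  have k: "4 \<le> k" using assms by (simp add: adm_def)
  have "(\<Sum>l=1..k. qp s (i, l) * mk v (l, j))
     = (\<Sum>l=1..k. (s * qv i * (v l * pv j + qv l * (eps j * v j))) * pv l)" for i j
    by (simp add: mk_def qp_def algebra_simps)
  moreover have "\<dots> i j = 0" for i j
    using assms by (simp add: adm_def sum_pq [OF k] pq_values del: One_nat_def)
  ultimately show "qp s \<otimes>\<^bsub>MAT k\<^esub> mk v = (\<lambda>_. 0)" by (auto simp: fun_eq_iff mult_MAT)
  have "(\<Sum>l=1..k. mk v (i, l) * qp s (l, j))
     = (\<Sum>l=1..k. (s * pv j * (v i * pv l + qv i * (eps l * v l))) * qv l)" for i j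
    by (simp add: mk_def qp_def algebra_simps)
  moreover have "\<dots> i j = 0" for i j
    using assms by (simp add: adm_def sum_pq [OF k] pq_values del: One_nat_def)
  ultimately show "mk v \<otimes>\<^bsub>MAT k\<^esub> qp s = (\<lambda>_. 0)" by (auto simp: fun_eq_iff mult_MAT)
  have "(\<Sum>l=1..k. qp s (i, l) * qp t (l, j))
     = (\<Sum>l=1..k. (s * t * qv i * pv j * qv l) * pv l)" for i j
    by (simp add: qp_def algebra_simps)
  moreover have "\<dots> i j = 0" for i j
    by (simp add: sum_pq [OF k] pq_values del: One_nat_def)
  ultimately show "qp s \<otimes>\<^bsub>MAT k\<^esub> qp t = (\<lambda>_. 0)" by (auto simp: fun_eq_iff mult_MAT)
qed

lemma carrier_mk: "adm k v \<Longrightarrow> mk v \<in> carrier (MAT k)"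
  by (auto simp: MAT_def mk_def adm_def pv_def qv_def)

lemma carrier_qp: "4 \<le> k \<Longrightarrow> qp s \<in> carrier (MAT k)"
  by (auto simp: MAT_def qp_def pv_def qv_def)

lemma mexp_mk:
  assumes "adm k v"
  shows "mexp k (mk v) = (\<lambda>p. \<one>\<^bsub>MAT k\<^esub> p + mk v p + qp (dotp k v v / 2) p)"
proof
  fix p
  have p0: "mk v [^]\<^bsub>MAT k\<^esub> (0::nat) = \<one>\<^bsub>MAT k\<^esub>"
    and ps: "mk v [^]\<^bsub>MAT k\<^esub> Suc i = mk v [^]\<^bsub>MAT k\<^esub> i \<otimes>\<^bsub>MAT k\<^esub> mk v" for i
    by (simp_all add: nat_pow_def)
  have p1: "mk v [^]\<^bsub>MAT k\<^esub> Suc 0 = mk v"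
    using mult_one_left [OF carrier_mk [OF assms]] by (simp add: p0 ps)
  have p2: "mk v [^]\<^bsub>MAT k\<^esub> Suc (Suc 0) = qp (dotp k v v)"
    unfolding ps [of "Suc 0"] p1 by (rule mk_mult [OF assms assms])
  have p3: "mk v [^]\<^bsub>MAT k\<^esub> Suc (Suc (Suc i)) = (\<lambda>_. 0)" for i
  proof (induction i)
    case 0
    show ?case unfolding ps [of "Suc (Suc 0)"] p2 by (rule qp_mult [OF assms])
  next
    case (Suc i)
    show ?case unfolding ps [of "Suc (Suc (Suc i))"] Suc by (auto simp: fun_eq_iff mult_MAT)
  qed
  have "(\<Sum>i. (mk v [^]\<^bsub>MAT k\<^esub> (i::nat)) p / fact i)
      = (\<Sum>i\<in>{0, Suc 0, Suc (Suc 0)}. (mk v [^]\<^bsub>MAT k\<^esub> (i::nat)) p / fact i)"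
  proof (rule suminf_finite)
    fix i :: nat assume "i \<notin> {0, Suc 0, Suc (Suc 0)}"
    then obtain l where "i = Suc (Suc (Suc l))"
      by (metis insertI1 insertI2 old.nat.exhaust)
    thus "(mk v [^]\<^bsub>MAT k\<^esub> i) p / fact i = 0" using p3 [of l] by simp
  qed simp
  thus "mexp k (mk v) p = \<one>\<^bsub>MAT k\<^esub> p + mk v p + qp (dotp k v v / 2) p"
    by (simp add: mexp_def p0 p1 p2 qp_def del: nat_pow_Suc split: prod.split)
qed

lemma adm_add: "adm k v \<Longrightarrow> adm k w \<Longrightarrow> adm k (\<lambda>c. v c + w c)"
  by (auto simp: adm_def)

lemma mult_distrib_MAT:
  "(\<lambda>p. A p + B p) \<otimes>\<^bsub>MAT k\<^esub> C = (\<lambda>p. (A \<otimes>\<^bsub>MAT k\<^esub> C) p + (B \<otimes>\<^bsub>MAT k\<^esub> C) p)"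
  "C \<otimes>\<^bsub>MAT k\<^esub> (\<lambda>p. A p + B p) = (\<lambda>p. (C \<otimes>\<^bsub>MAT k\<^esub> A) p + (C \<otimes>\<^bsub>MAT k\<^esub> B) p)"
  by (auto simp: fun_eq_iff mult_MAT sum.distrib algebra_simps)

lemma mult_one_right:
  assumes "A \<in> carrier (MAT k)"
  shows "A \<otimes>\<^bsub>MAT k\<^esub> \<one>\<^bsub>MAT k\<^esub> = A"
proof
  fix p :: "nat \<times> nat"
  obtain i j where p: "p = (i, j)" by (cases p)
  have "(\<Sum>l=1..k. A (i, l) * \<one>\<^bsub>MAT k\<^esub> (l, j)) = (\<Sum>l=1..k. if j = l then A (i, l) else 0)"
    by (rule sum.cong) (auto simp: one_MAT)
  also have "\<dots> = A (i, j)" using assms by (auto simp: MAT_def)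
  finally show "(A \<otimes>\<^bsub>MAT k\<^esub> \<one>\<^bsub>MAT k\<^esub>) p = A p" by (simp add: p mult_MAT)
qed

lemma mexp_mk_mult:
  assumes "adm k v" "adm k w"
  shows "mexp k (mk v) \<otimes>\<^bsub>MAT k\<^esub> mexp k (mk w) = mexp k (mk (\<lambda>c. v c + w c))"
proof -
  have k: "4 \<le> k" using assms by (simp add: adm_def)
  have one: "\<one>\<^bsub>MAT k\<^esub> \<in> carrier (MAT k)" by (auto simp: MAT_def)
  note carr = carrier_mk [OF assms(1)] carrier_mk [OF assms(2)] carrier_qp [OF k] one
  have mk: "mk (\<lambda>c. v c + w c) p = mk v p + mk w p" for p
    by (auto simp: mk_def algebra_simps split: prod.split)
  have d: "dotp k (\<lambda>c. v c + w c) (\<lambda>c. v c + w c) = dotp k v v + (dotp k w w + 2 * dotp k v w)"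
    by (simp add: dotp_def sum.distrib [symmetric] sum_distrib_left algebra_simps)
  have q: "qp ((dotp k v v + (dotp k w w + 2 * dotp k v w)) / 2) p
     = qp (dotp k v w) p + (qp (dotp k v v / 2) p + qp (dotp k w w / 2) p)" for p
    by (auto simp: qp_def algebra_simps split: prod.split)
  show ?thesis
    unfolding mexp_mk [OF assms(1)] mexp_mk [OF assms(2)] mexp_mk [OF adm_add [OF assms]]
    by (simp add: mult_distrib_MAT mult_one_left mult_one_right carr mk_mult [OF assms]
        qp_mult [OF assms(1)] qp_mult [OF assms(2)] mk d q add_ac)
qed

definition pos :: "nat \<Rightarrow> nat" where
  "pos i = (if i \<le> 2 then i + 1 else i + 2)"

definition vec_of :: "nat \<Rightarrow> (nat \<Rightarrow> real) \<Rightarrow> nat \<Rightarrow> real" where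
  "vec_of m x c = (\<Sum>i=1..m-1. if c = pos i then x i else 0)"

definition basis :: "nat \<Rightarrow> matrix" where
  "basis i = (if i = 1 then Qminus1 else if i = 2 then Qminus2 else Yminus (i - 2))"

lemma mk_basis:
  assumes "1 \<le> i"
  shows "mk (\<lambda>c. if c = pos i then t else 0) = mscale t (basis i)"
proof -
  have "i = 1 \<or> i = 2 \<or> (\<exists>l. i = l + 3)" using assms
    by (metis One_nat_def Suc_1 add.commute le_Suc_ex less_2_cases_iff linorder_not_less
        nat_less_le numeral_3_eq_3 not_less_eq_eq Suc_leI)
  thus ?thesis
    by (elim disjE exE)
      (auto simp: fun_eq_iff mk_def mscale_def basis_def pos_def Qminus1_def Qminus2_def Yminus_def
        Emat_def pv_def qv_def eps_def)
qed

lemma nminus_mk: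
  assumes "3 \<le> m"
  shows "nminus m x = mk (vec_of m x)"
proof
  fix p :: "nat \<times> nat"
  obtain a b where p: "p = (a, b)" by (cases p)
  have "mk (vec_of m x) p = (\<Sum>i=1..m-1. mk (\<lambda>c. if c = pos i then x i else 0) p)"
    by (simp add: p mk_def vec_of_def sum.distrib sum_distrib_left sum_distrib_right)
  also have "\<dots> = (\<Sum>i=1..m-1. x i * basis i p)"
    by (rule sum.cong) (simp_all add: mk_basis mscale_def)
  also have "{1..m-1} = {1, 2} \<union> {3..m-1}" using assms by auto
  also have "(\<Sum>i\<in>{1, 2} \<union> {3..m-1}. x i * basis i p)
      = (\<Sum>i\<in>{1, 2}. x i * basis i p) + (\<Sum>i=3..m-1. x i * basis i p)"
    by (rule sum.union_disjoint) auto
  also have "(\<Sum>i=3..m-1. x i * basis i p) = (\<Sum>i=3..m-1. x i * Yminus (i - 2) p)"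
    by (rule sum.cong) (simp_all add: basis_def)
  finally show "nminus m x p = mk (vec_of m x) p" by (simp add: nminus_def basis_def)
qed

lemma pos_bounds:
  assumes "3 \<le> m" "i \<in> {1..m-1}"
  shows "pos i \<noteq> 1" "pos i \<noteq> 4" "pos i \<in> {1..m+1}"
  using assms by (auto simp: pos_def)

lemma adm_vec_of:
  assumes "3 \<le> m"
  shows "adm (m + 1) (vec_of m x)"
proof -
  have "vec_of m x c = 0" if "c = 1 \<or> c = 4 \<or> c \<notin> {1..m+1}" for c
    unfolding vec_of_def using that pos_bounds [OF assms]
    by (intro sum.neutral) (metis (full_types))
  moreover have "4 \<le> m + 1" using assms by linarith
  ultimately show ?thesis by (auto simp only: adm_def)
qed

lemma adm_single:
  assumes "3 \<le> m" "i \<in> {1..m-1}"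
  shows "adm (m + 1) (\<lambda>c. if c = pos i then t else 0)"
proof -
  have "(if c = pos i then t else 0) = 0" if "c = 1 \<or> c = 4 \<or> c \<notin> {1..m+1}" for c
    using that pos_bounds [OF assms] by metis
  moreover have "4 \<le> m + 1" using assms by linarith
  ultimately show ?thesis by (auto simp only: adm_def)
qed

lemma mexp_translate:
  assumes "3 \<le> m" "i \<in> {1..m-1}"
  shows "mexp (m + 1) (nminus m x) \<otimes>\<^bsub>MAT (m + 1)\<^esub> mexp (m + 1) (mscale t (basis i))
    = mexp (m + 1) (nminus m (x(i := x i + t)))"
proof -
  have v: "vec_of m (x(i := x i + t)) = (\<lambda>c. vec_of m x c + (if c = pos i then t else 0))"
  proof
    fix c
    have "vec_of m (x(i := x i + t)) c
        = (\<Sum>l=1..m-1. (if c = pos l then x l else 0) + (if l = i then (if c = pos i then t else 0) else 0))"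
      unfolding vec_of_def by (rule sum.cong) auto
    also have "\<dots> = vec_of m x c + (if c = pos i then t else 0)"
      using assms(2) by (simp add: sum.distrib vec_of_def)
    finally show "vec_of m (x(i := x i + t)) c = vec_of m x c + (if c = pos i then t else 0)" .
  qed
  have "1 \<le> i" using assms by simp
  have "mexp (m + 1) (nminus m x) \<otimes>\<^bsub>MAT (m + 1)\<^esub> mexp (m + 1) (mscale t (basis i))
      = mexp (m + 1) (mk (vec_of m x)) \<otimes>\<^bsub>MAT (m + 1)\<^esub>
        mexp (m + 1) (mk (\<lambda>c. if c = pos i then t else 0))"
    by (simp only: nminus_mk [OF assms(1)] mk_basis [OF \<open>1 \<le> i\<close>])
  also have "\<dots> = mexp (m + 1) (mk (\<lambda>c. vec_of m x c + (if c = pos i then t else 0)))"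
    by (rule mexp_mk_mult [OF adm_vec_of [OF assms(1)] adm_single [OF assms]])
  also have "\<dots> = mexp (m + 1) (nminus m (x(i := x i + t)))"
    by (simp only: nminus_mk [OF assms(1)] v)
  finally show ?thesis .
qed

subsection \<open>The operators in coordinates\<close>

lemma vector_derivative_shift:
  fixes f :: "real \<Rightarrow> complex"
  shows "vector_derivative (\<lambda>t. f (c + t)) (at 0) = vector_derivative f (at c)"
proof -
  have "((\<lambda>t. f (c + t)) has_vector_derivative d) (at 0) \<longleftrightarrow> (f has_vector_derivative d) (at c)" for d
  proof
    assume "(f has_vector_derivative d) (at c)"
    hence "(f has_vector_derivative d) (at ((\<lambda>t. c + t) 0))" by simp
    moreover have "((\<lambda>t. c + t) has_vector_derivative 1) (at (0::real))"
      by (auto intro!: derivative_eq_intros)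
    ultimately show "((\<lambda>t. f (c + t)) has_vector_derivative d) (at 0)"
      using vector_diff_chain_at [of "\<lambda>t. c + t" 1 0 f d] by (simp add: o_def)
  next
    assume "((\<lambda>t. f (c + t)) has_vector_derivative d) (at 0)"
    hence "((\<lambda>t. f (c + t)) has_vector_derivative d) (at ((\<lambda>s. s - c) c))" by simp
    moreover have "((\<lambda>s. s - c) has_vector_derivative 1) (at c)"
      by (auto intro!: derivative_eq_intros)
    ultimately show "(f has_vector_derivative d) (at c)"
      using vector_diff_chain_at [of "\<lambda>s. s - c" 1 c "\<lambda>t. f (c + t)" d] by (simp add: o_def)
  qed
  thus ?thesis by (simp add: vector_derivative_def)
qed

lemma \<beta>_R:
  assumes "3 \<le> m" "i \<in> {1..m-1}"
  shows "\<beta> m (R_act m (basis i) u) = pd i (\<beta> m u)"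
proof
  fix x
  have "\<beta> m (R_act m (basis i) u) x = vector_derivative (\<lambda>t. \<beta> m u (x(i := x i + t))) (at 0)"
    using mexp_translate [OF assms] by (simp add: \<beta>_def R_act_def)
  also have "\<dots> = pd i (\<beta> m u) x"
    unfolding pd_def by (rule vector_derivative_shift)
  finally show "\<beta> m (R_act m (basis i) u) x = pd i (\<beta> m u) x" .
qed

lemma \<beta>_R_lap:
  assumes "4 \<le> n"
  shows "\<beta> (n + 1) (R_lap n u) = lapM n (\<beta> (n + 1) u)"
proof
  fix x
  have b: "\<beta> (n + 1) (R_act (n + 1) (basis i) (R_act (n + 1) (basis i) u)) = pd i (pd i (\<beta> (n + 1) u))"
    if "i \<in> {1..n}" for i
    using \<beta>_R [of "n + 1" i] that assms by simp
  let ?f = "\<lambda>i. \<beta> (n + 1) (R_act (n + 1) (basis i) (R_act (n + 1) (basis i) u)) x"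
  have "(\<Sum>i=2..n-1. pd i (pd i (\<beta> (n + 1) u)) x) = (\<Sum>i=2..n-1. ?f i)"
  proof (rule sum.cong [OF refl])
    fix i assume "i \<in> {2..n-1}"
    hence "i \<in> {1..n}" by auto
    thus "pd i (pd i (\<beta> (n + 1) u)) x = ?f i" by (simp only: b)
  qed
  also have "\<dots> = (\<Sum>i\<in>insert 2 {3..n-1}. ?f i)"
    by (rule sum.cong) (use assms in auto)
  also have "(\<Sum>i\<in>insert 2 {3..n-1}. ?f i) = ?f 2 + (\<Sum>i=3..n-1. ?f i)" by simp
  also have "(\<Sum>i=3..n-1. ?f i) = (\<Sum>j=1..n-3. ?f (j + 2))"
    by (rule sum.reindex_bij_witness [of _ "\<lambda>j. j + 2" "\<lambda>i. i - 2"]) (auto simp del: add_2_eq_Suc')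
  also have "\<dots> = (\<Sum>j=1..n-3. \<beta> (n + 1) (R_act (n + 1) (Yminus j) (R_act (n + 1) (Yminus j) u)) x)"
    by (rule sum.cong) (auto simp: basis_def)
  finally have s: "(\<Sum>i=2..n-1. pd i (pd i (\<beta> (n + 1) u)) x) = ?f 2
     + (\<Sum>j=1..n-3. \<beta> (n + 1) (R_act (n + 1) (Yminus j) (R_act (n + 1) (Yminus j) u)) x)" .
  have "pd 1 (pd 1 (\<beta> (n + 1) u)) x = ?f 1" using b [of 1] assms by simp
  with s show "\<beta> (n + 1) (R_lap n u) x = lapM n (\<beta> (n + 1) u) x"
    unfolding lapM_def by (simp add: R_lap_def \<beta>_def basis_def)
qed

lemma pd_istar: "i \<noteq> n \<Longrightarrow> pd i (istar n f) = istar n (pd i f)"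
  by (auto simp: fun_eq_iff pd_def istar_def fun_upd_twist)

lemma lapM_istar:
  assumes "2 \<le> n"
  shows "lapM n (istar n f) = istar n (lapM n f)"
proof -
  have "pd i (pd i (istar n f)) = istar n (pd i (pd i f))" if "i \<in> {1..n-1}" for i
  proof -
    have "i \<noteq> n" using that assms by auto
    thus ?thesis by (simp add: pd_istar)
  qed
  thus ?thesis using assms by (simp add: lapM_def fun_eq_iff) (simp add: istar_def)
qed

lemma embed_mexp:
  assumes "4 \<le> n"
  shows "embed n (mexp (n + 1) (nminus n x)) = mexp (n + 2) (nminus (n + 1) (x(n := 0)))"
proof -
  have v: "vec_of (n + 1) (x(n := 0)) = vec_of n x"
  proof
    fix c
    have "{1..n} = insert n {1..n-1}" using assms by auto
    hence "vec_of (n + 1) (x(n := 0)) c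
        = (\<Sum>i\<in>insert n {1..n-1}. if c = pos i then (x(n := 0)) i else 0)"
      by (simp add: vec_of_def)
    also have "\<dots> = (\<Sum>i=1..n-1. if c = pos i then (x(n := 0)) i else 0)"
      using assms by (subst sum.insert) auto
    also have "\<dots> = vec_of n x c" unfolding vec_of_def using assms by (intro sum.cong) auto
    finally show "vec_of (n + 1) (x(n := 0)) c = vec_of n x c" .
  qed
  have ad: "adm (n + 1) (vec_of n x)" using adm_vec_of [of n] assms by simp
  have ad': "adm (n + 2) (vec_of n x)" using ad by (auto simp: adm_def)
  have d: "dotp (n + 2) (vec_of n x) (vec_of n x) = dotp (n + 1) (vec_of n x) (vec_of n x)"
    using ad by (simp add: dotp_def adm_def)
  have z: "vec_of n x (n + 2) = 0" using ad by (simp add: adm_def)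
  have n: "3 \<le> n" "3 \<le> n + 1" using assms by auto
  show ?thesis
    unfolding nminus_mk [OF n(1)] nminus_mk [OF n(2)] v mexp_mk [OF ad] mexp_mk [OF ad'] d
    using assms z by (auto simp: embed_def fun_eq_iff one_MAT mk_def qp_def pv_def qv_def)
qed

theorem D_nc_beta:
  assumes "4 \<le> n" "u \<in> Ind (n + 1) lam"
  shows "\<beta> n (D_group n N lam u) = D_nc n N lam (\<beta> (n + 1) u)"
proof
  fix x
  have Y: "\<beta> (n + 1) ((R_act (n + 1) (Yminus (n - 2)) ^^ k) w) = (pd n ^^ k) (\<beta> (n + 1) w)" for k w
  proof (induction k)
    case (Suc k)
    show ?case using \<beta>_R [of "n + 1" n] assms(1) Suc by (simp add: basis_def)
  qed simp
  have L: "\<beta> (n + 1) ((R_lap n ^^ j) w) = (lapM n ^^ j) (\<beta> (n + 1) w)" for j w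
    by (induction j) (simp_all add: \<beta>_R_lap [OF assms(1)] del: add_Suc_right One_nat_def)
  have I: "(lapM n ^^ j) (istar n f) = istar n ((lapM n ^^ j) f)" for j f
    using assms(1) by (induction j) (simp_all add: lapM_istar)
  have e: "w (embed n (mexp (n + 1) (nminus n x))) = istar n (\<beta> (n + 1) w) x" for w
    by (simp only: embed_mexp [OF assms(1)] istar_def \<beta>_def add.assoc one_add_one)
  show "\<beta> n (D_group n N lam u) x = D_nc n N lam (\<beta> (n + 1) u) x"
    by (simp only: \<beta>_def [of n] D_group_def D_nc_def e L Y I)
qed

end

theory Submission
  imports Defs
begin

text \<open>
  Comparing coefficients of \<open>x\<^sub>n\<close>-powers, a formal solution with leading exponent \<open>s\<close> is a sequence of
  smooth functions with \<open>\<Delta>\<^sub>M c\<^sub>j\<^sub>-\<^sub>1 = \<theta>\<^sub>j c\<^sub>j\<close>, where \<open>\<theta>\<^sub>j = 2 j (n - 1 - 2 s - 2 j)\<close>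
  (\<open>formal_solution_iff\<close>).  If no \<open>\<theta>\<^sub>i\<close> with \<open>1 \<le> i \<le> N\<close> vanishes, then the operator sending
  \<open>c\<^sub>0\<close> to \<open>c\<^sub>j\<close> is \<open>\<Delta>\<^sub>M\<^sup>j / (\<theta>\<^sub>1 \<cdots> \<theta>\<^sub>j)\<close>.  If \<open>\<theta>\<^sub>j = 0\<close>, the choice
  \<open>c\<^sub>0 = \<dots> = c\<^sub>j\<^sub>-\<^sub>1 = 0\<close> allows any \<open>c\<^sub>j\<close>.  So the coefficients up to order \<open>N\<close> are determined exactly away from the zeros of
  \<open>\<theta>\<^sub>1 \<cdots> \<theta>\<^sub>N\<close> (\<open>determined_iff\<close>), a finite set of parameters.

  Both families are therefore combinations of the same operators
  \<open>\<Delta>\<^sub>M\<^sup>j i\<^sup>* \<partial>\<^sub>n\<^sup>2\<^sup>N\<^sup>-\<^sup>2\<^sup>j\<close>, and only the scalars are to be compared.  At \<open>s = lam + n - 1 - 2 N\<close> one has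
  \<open>\<theta>\<^sub>j = - 2 j (n - 1 + 2 lam - 4 N + 2 j)\<close>, which is \<open>-2\<close> times one factor in the two-term
  recurrence for the coefficients \<open>a\<^sub>j\<close>; twice the other factor is the quotient
  \<open>(2 N - 2 j + 2)! / (2 N - 2 j)!\<close> of factorials.  Hence the scalars \<open>1 / ((2 N - 2 j)! \<theta>\<^sub>1 \<cdots> \<theta>\<^sub>j)\<close> obey the
  recurrence of the \<open>a\<^sub>j\<close>, and comparing them at \<open>j = N\<close> gives the ratio
  \<open>1 / (\<theta>\<^sub>1 \<cdots> \<theta>\<^sub>N)\<close> (\<open>coefficient_ratio\<close>).
\<close>

section \<open>Operations on smooth functions\<close>

lemma C_inftyI:
  assumes "\<And>x y. (\<And>i. i \<in> I \<Longrightarrow> x i = y i) \<Longrightarrow> f x = f y"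
    and "\<And>is. set is \<subseteq> I \<Longrightarrow> continuous_on UNIV (foldr pd is f)"
    and "\<And>is i x. set is \<subseteq> I \<Longrightarrow> i \<in> I \<Longrightarrow>
      (\<lambda>t. foldr pd is f (x(i := t))) differentiable (at (x i))"
  shows "f \<in> C_infty I"
  using assms unfolding C_infty_def by blast

lemma C_infty_cong: "f \<in> C_infty I \<Longrightarrow> (\<And>i. i \<in> I \<Longrightarrow> x i = y i) \<Longrightarrow> f x = f y"
  unfolding C_infty_def by blast

lemma C_infty_continuous: "f \<in> C_infty I \<Longrightarrow> set is \<subseteq> I \<Longrightarrow> continuous_on UNIV (foldr pd is f)"
  unfolding C_infty_def by blast

lemma C_infty_differentiable:
  "f \<in> C_infty I \<Longrightarrow> set is \<subseteq> I \<Longrightarrow> i \<in> I \<Longrightarrow>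
    (\<lambda>t. foldr pd is f (x(i := t))) differentiable (at (x i))"
  unfolding C_infty_def by blast

lemma C_infty_pd:
  assumes f: "f \<in> C_infty I" and i: "i \<in> I"
  shows "pd i f \<in> C_infty I"
proof (rule C_inftyI)
  fix x y :: "'a \<Rightarrow> real" assume xy: "\<And>k. k \<in> I \<Longrightarrow> x k = y k"
  have "f (x(i := t)) = f (y(i := t))" for t
    by (rule C_infty_cong [OF f]) (simp add: xy)
  thus "pd i f x = pd i f y" using xy [OF i] by (simp add: pd_def)
next
  fix "is" assume "set is \<subseteq> I"
  thus "continuous_on UNIV (foldr pd is (pd i f))"
    using C_infty_continuous [OF f, of "is @ [i]"] i by simp
next
  fix "is" k x assume "set is \<subseteq> I" "k \<in> I"
  thus "(\<lambda>t. foldr pd is (pd i f) (x(k := t))) differentiable (at (x k))"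
    using C_infty_differentiable [OF f, of "is @ [i]" k x] i by simp
qed

lemma C_infty_pd_iterate: "f \<in> C_infty I \<Longrightarrow> i \<in> I \<Longrightarrow> (pd i ^^ k) f \<in> C_infty I"
  by (induction k) (auto intro: C_infty_pd)

lemma foldr_pd_linear:
  assumes f: "f \<in> C_infty I" and g: "g \<in> C_infty I" and "set is \<subseteq> I"
  shows "foldr pd is (\<lambda>x. a * f x + b * g x) = (\<lambda>x. a * foldr pd is f x + b * foldr pd is g x)"
  using assms(3)
proof (induction "is")
  case (Cons i "is")
  hence i: "i \<in> I" "set is \<subseteq> I" by auto
  show ?case
  proof
    fix x
    let ?F = "\<lambda>t. foldr pd is f (x(i := t))" and ?G = "\<lambda>t. foldr pd is g (x(i := t))"
    have "(?F has_vector_derivative vector_derivative ?F (at (x i))) (at (x i))"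
      "(?G has_vector_derivative vector_derivative ?G (at (x i))) (at (x i))"
      using C_infty_differentiable [OF f i(2,1)] C_infty_differentiable [OF g i(2,1)]
      by (simp_all add: vector_derivative_works)
    hence "((\<lambda>t. a * ?F t + b * ?G t) has_vector_derivative
        a * vector_derivative ?F (at (x i)) + b * vector_derivative ?G (at (x i))) (at (x i))"
      by (intro has_vector_derivative_add has_vector_derivative_mult_right)
    thus "foldr pd (i # is) (\<lambda>x. a * f x + b * g x) x
        = a * foldr pd (i # is) f x + b * foldr pd (i # is) g x"
      by (simp add: Cons.IH [OF i(2)] pd_def [of i] vector_derivative_at)
  qed
qed simp

lemma C_infty_linear:
  assumes f: "f \<in> C_infty I" and g: "g \<in> C_infty I"
  shows "(\<lambda>x. a * f x + b * g x) \<in> C_infty I"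
proof (rule C_inftyI)
  fix x y :: "'a \<Rightarrow> real" assume "\<And>k. k \<in> I \<Longrightarrow> x k = y k"
  thus "a * f x + b * g x = a * f y + b * g y"
    using C_infty_cong [OF f] C_infty_cong [OF g] by metis
next
  fix "is" assume "set is \<subseteq> I"
  thus "continuous_on UNIV (foldr pd is (\<lambda>x. a * f x + b * g x))"
    unfolding foldr_pd_linear [OF f g \<open>set is \<subseteq> I\<close>]
    by (intro continuous_intros C_infty_continuous [OF f] C_infty_continuous [OF g])
next
  fix "is" k x assume "set is \<subseteq> I" "k \<in> I"
  thus "(\<lambda>t. foldr pd is (\<lambda>x. a * f x + b * g x) (x(k := t))) differentiable (at (x k))"
    unfolding foldr_pd_linear [OF f g \<open>set is \<subseteq> I\<close>]
    by (intro differentiable_add differentiable_mult differentiable_const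
        C_infty_differentiable [OF f] C_infty_differentiable [OF g])
qed

lemma foldr_pd_const: "foldr pd is (\<lambda>_. c) = (\<lambda>_. if is = [] then c else 0)"
  by (induction "is") (auto simp: pd_def fun_eq_iff)

lemma C_infty_const: "(\<lambda>_. c) \<in> C_infty I"
  by (rule C_inftyI) (auto simp: foldr_pd_const)

lemma C_infty_cmult: "f \<in> C_infty I \<Longrightarrow> (\<lambda>x. a * f x) \<in> C_infty I"
  using C_infty_linear [of f I "\<lambda>_. 0" a 0] by (simp add: C_infty_const)

lemma C_infty_sum: "(\<And>k. k \<in> K \<Longrightarrow> f k \<in> C_infty I) \<Longrightarrow> (\<lambda>x. \<Sum>k\<in>K. f k x) \<in> C_infty I"
proof (induction K rule: infinite_finite_induct)
  case (insert k K)
  thus ?case using C_infty_linear [of "f k" I "\<lambda>x. \<Sum>k\<in>K. f k x" 1 1] by simp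
qed (simp_all add: C_infty_const)

lemma C_infty_lapM:
  assumes "2 \<le> n" and f: "f \<in> C_infty {1..n-1}"
  shows "lapM n f \<in> C_infty {1..n-1}"
proof -
  have d: "pd i (pd i f) \<in> C_infty {1..n-1}" if "i \<in> {1..n-1}" for i
    using that by (intro C_infty_pd f)
  have "(\<lambda>x. -1 * pd 1 (pd 1 f) x + 1 * (\<Sum>i=2..n-1. pd i (pd i f) x)) \<in> C_infty {1..n-1}"
    by (rule C_infty_linear, rule d, use assms(1) in simp, rule C_infty_sum, rule d) simp
  thus ?thesis by (simp add: lapM_def)
qed

lemma C_infty_lapM_iterate:
  "2 \<le> n \<Longrightarrow> f \<in> C_infty {1..n-1} \<Longrightarrow> (lapM n ^^ j) f \<in> C_infty {1..n-1}"
  by (induction j) (simp_all add: C_infty_lapM del: One_nat_def)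

lemma lapM_cmult:
  assumes "2 \<le> n" and f: "f \<in> C_infty {1..n-1}"
  shows "lapM n (\<lambda>x. a * f x) = (\<lambda>x. a * lapM n f x)"
proof -
  have "pd i (pd i (\<lambda>x. a * f x)) = (\<lambda>x. a * pd i (pd i f) x)" if "i \<in> {1..n-1}" for i
    using foldr_pd_linear [OF f C_infty_const, of "[i, i]" a 0] that by simp
  thus ?thesis using assms(1) by (simp add: lapM_def sum_distrib_left algebra_simps)
qed

lemma lapM_zero: "lapM n (\<lambda>_. 0) = (\<lambda>_. 0)"
proof -
  have "pd i (\<lambda>_. 0) = (\<lambda>_. 0)" for i :: nat
    using foldr_pd_const [of "[i]" 0] by simp
  thus ?thesis by (simp add: lapM_def)
qed

lemma foldr_pd_istar: "n \<notin> set is \<Longrightarrow> foldr pd is (istar n f) = istar n (foldr pd is f)"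
  by (induction "is") (auto simp: pd_istar)

lemma C_infty_istar:
  assumes f: "f \<in> C_infty {1..n}"
  shows "istar n f \<in> C_infty {1..n-1}"
proof (cases "n = 0")
  case True
  have "istar n f x = istar n f y" for x y
    unfolding istar_def by (rule C_infty_cong [OF f]) (simp add: True)
  hence "istar n f = (\<lambda>_. istar n f (\<lambda>_. 0))" by blast
  thus ?thesis using C_infty_const by metis
next
  case False
  show ?thesis
  proof (rule C_inftyI)
    fix x y :: "nat \<Rightarrow> real" assume xy: "\<And>i. i \<in> {1..n-1} \<Longrightarrow> x i = y i"
    show "istar n f x = istar n f y"
      unfolding istar_def by (rule C_infty_cong [OF f]) (auto intro: xy)
  next
    fix "is" assume "is": "set is \<subseteq> {1..n-1}"
    moreover have "n \<notin> {1..n-1}" "{1..n-1} \<subseteq> {1..n}" using False by auto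
    ultimately have "n \<notin> set is" "set is \<subseteq> {1..n}" by blast+
    moreover have "continuous_on UNIV (\<lambda>x :: nat \<Rightarrow> real. x(n := 0))"
    proof (rule continuous_on_coordinatewise_then_product)
      show "continuous_on UNIV (\<lambda>x :: nat \<Rightarrow> real. (x(n := 0)) i)" for i
        by (cases "i = n") (auto intro!: continuous_intros)
    qed
    ultimately show "continuous_on UNIV (foldr pd is (istar n f))"
      unfolding foldr_pd_istar [OF \<open>n \<notin> set is\<close>] unfolding istar_def
      by (intro continuous_on_compose2 [OF C_infty_continuous [OF f]]) auto
  next
    fix "is" i x assume "is": "set is \<subseteq> {1..n-1}" "i \<in> {1..n-1}"
    moreover have "n \<notin> {1..n-1}" "{1..n-1} \<subseteq> {1..n}" using False by auto
    ultimately have n: "n \<notin> set is" "set is \<subseteq> {1..n}" "i \<in> {1..n}" "i \<noteq> n"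
      by blast+
    thus "(\<lambda>t. foldr pd is (istar n f) (x(i := t))) differentiable (at (x i))"
      using C_infty_differentiable [OF f n(2,3), of "x(n := 0)"]
      unfolding foldr_pd_istar [OF n(1)] by (simp add: istar_def fun_upd_twist)
  qed
qed

section \<open>The recursion for the coefficients of a formal solution\<close>

text \<open>The difference of the values of the indicial polynomial \<open>\<mu> (n - 1 - \<mu>)\<close> at \<open>s + 2 j\<close> and
  at \<open>s\<close>.\<close>

definition indicial :: "nat \<Rightarrow> complex \<Rightarrow> nat \<Rightarrow> complex" where
  "indicial n s j = 2 * of_nat j * (of_nat n - 1 - 2 * s - 2 * of_nat j)"

lemma series_at: "series s c (s + 2 * of_nat j) = c j"
proof -
  have "{k. s + 2 * of_nat j = s + 2 * of_nat k} = {j}" by auto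
  thus ?thesis by (simp add: series_def)
qed

lemma series_below: "series s c (s - 2) = (\<lambda>_. 0)"
proof -
  have "s - 2 \<noteq> s + 2 * of_nat k" for k
  proof
    assume "s - 2 = s + 2 * of_nat k"
    hence "Re (s - 2) = Re (s + 2 * of_nat k)" by (rule arg_cong)
    thus False by simp
  qed
  hence "{k. s - 2 = s + 2 * of_nat k} = {}" by blast
  thus ?thesis by (simp only: series_def sum.empty)
qed

lemma lapU_series:
  "lapU n (series s c) (s + 2 * of_nat j) x
     = (case j of 0 \<Rightarrow> 0 | Suc i \<Rightarrow> lapM n (c i) x)
       + (s + 2 * of_nat j) * (s + 2 * of_nat j - (of_nat n - 1)) * c j x"
proof -
  have lapU: "lapU n f \<mu> x
      = lapM n (f (\<mu> - 2)) x + \<mu> * (\<mu> - (of_nat n - 1)) * f \<mu> x" for f \<mu>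
    by (simp add: lapU_def mul_xn_def d_xn_def) (simp add: algebra_simps)
  have "lapM n (series s c (s + 2 * of_nat j - 2)) x
      = (case j of 0 \<Rightarrow> 0 | Suc i \<Rightarrow> lapM n (c i) x)"
  proof (cases j)
    case 0
    thus ?thesis using series_below [of s c] by (simp add: lapM_zero)
  next
    case (Suc i)
    hence "s + 2 * of_nat j - 2 = s + 2 * of_nat i" by simp
    thus ?thesis using Suc by (simp only: series_at nat.case)
  qed
  thus ?thesis by (simp only: lapU series_at)
qed

text \<open>
  The power \<open>\<mu> = s + 2 j\<close> receives \<open>\<Delta>\<^sub>M c\<^sub>j\<^sub>-\<^sub>1\<close>, because \<open>\<Delta>\<^sub>M\<close> comes with \<open>x\<^sub>n\<^sup>2\<close>, and a multiple of
  \<open>c\<^sub>j\<close> with the factor \<open>\<mu> (n - 1 - \<mu>) - s (n - 1 - s) = (\<mu> - s) (n - 1 - \<mu> - s)\<close>.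
  In lowest order it vanishes, so \<open>c\<^sub>0\<close> is free.
\<close>

lemma formal_solution_iff:
  "formal_solution n s J c \<longleftrightarrow>
     (\<forall>j\<le>J. c j \<in> C_infty {1..n-1}) \<and>
     (\<forall>j<J. lapM n (c j) = (\<lambda>x. indicial n s (Suc j) * c (Suc j) x))"
proof -
  let ?eq = "\<lambda>j x. - lapU n (series s c) (s + 2 * of_nat j) x
     = s * (of_nat n - 1 - s) * series s c (s + 2 * of_nat j) x"
  have z: "?eq 0 x" for x
    by (simp only: lapU_series series_at) (simp add: algebra_simps)
  have S: "?eq (Suc i) x \<longleftrightarrow> lapM n (c i) x = indicial n s (Suc i) * c (Suc i) x" for i x
  proof -
    have "?eq (Suc i) x \<longleftrightarrow> lapM n (c i) x =
        - (s + 2 * of_nat (Suc i)) * (s + 2 * of_nat (Suc i) - (of_nat n - 1)) * c (Suc i) x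
        - s * (of_nat n - 1 - s) * c (Suc i) x"
      by (simp only: lapU_series series_at nat.case) (auto simp: algebra_simps)
    also have "- (s + 2 * of_nat (Suc i)) * (s + 2 * of_nat (Suc i) - (of_nat n - 1)) * c (Suc i) x
        - s * (of_nat n - 1 - s) * c (Suc i) x = indicial n s (Suc i) * c (Suc i) x"
      by (simp only: indicial_def) (simp add: algebra_simps)
    finally show ?thesis .
  qed
  have "(\<forall>j\<le>J. \<forall>x. ?eq j x) \<longleftrightarrow> (\<forall>j<J. \<forall>x. ?eq (Suc j) x)"
  proof
    assume r: "\<forall>j<J. \<forall>x. ?eq (Suc j) x"
    show "\<forall>j\<le>J. \<forall>x. ?eq j x"
    proof (intro allI impI)
      fix j x assume "j \<le> J"
      thus "?eq j x" using r z by (cases j) auto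
    qed
  next
    assume l: "\<forall>j\<le>J. \<forall>x. ?eq j x"
    show "\<forall>j<J. \<forall>x. ?eq (Suc j) x"
    proof (intro allI impI)
      fix j x assume "j < J"
      hence "Suc j \<le> J" by simp
      thus "?eq (Suc j) x" using l by (elim allE [of _ "Suc j"] impE allE [of _ x])
    qed
  qed
  thus ?thesis unfolding formal_solution_def S by (auto simp: fun_eq_iff)
qed

lemma formal_solution_coefficient:
  assumes n: "2 \<le> n" and sol: "formal_solution n s J c"
    and nz: "\<And>i. i \<in> {1..J} \<Longrightarrow> indicial n s i \<noteq> 0" and "j \<le> J"
  shows "c j = (\<lambda>x. 1 / (\<Prod>i=1..j. indicial n s i) * (lapM n ^^ j) (c 0) x)"
  using \<open>j \<le> J\<close>
proof (induction j)
  case (Suc j)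
  have c0: "c 0 \<in> C_infty {1..n-1}" using sol by (simp add: formal_solution_iff)
  have "lapM n (c j) = (\<lambda>x. indicial n s (Suc j) * c (Suc j) x)"
    using sol Suc.prems by (simp add: formal_solution_iff)
  moreover have "lapM n (c j)
      = (\<lambda>x. 1 / (\<Prod>i=1..j. indicial n s i) * (lapM n ^^ Suc j) (c 0) x)"
    unfolding Suc.IH [OF Suc_leD [OF Suc.prems]] lapM_cmult [OF n C_infty_lapM_iterate [OF n c0]]
    by simp
  ultimately have "indicial n s (Suc j) * c (Suc j) x
      = 1 / (\<Prod>i=1..j. indicial n s i) * (lapM n ^^ Suc j) (c 0) x" for x
    by metis
  moreover have "indicial n s (Suc j) \<noteq> 0" using nz Suc.prems by simp
  ultimately have "c (Suc j) x
      = 1 / (\<Prod>i=1..j. indicial n s i) * (lapM n ^^ Suc j) (c 0) x / indicial n s (Suc j)" for x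
    by (metis nonzero_mult_div_cancel_left)
  thus ?case by (simp add: fun_eq_iff mult.commute del: funpow.simps)
qed simp

lemma is_coeff_iff:
  assumes n: "2 \<le> n" and c0: "c0 \<in> C_infty {1..n-1}"
    and nz: "\<And>i. i \<in> {1..j} \<Longrightarrow> indicial n s i \<noteq> 0"
  shows "is_coeff n j s c0 d \<longleftrightarrow>
    d = (\<lambda>x. 1 / (\<Prod>i=1..j. indicial n s i) * (lapM n ^^ j) c0 x)"
proof
  assume "is_coeff n j s c0 d"
  then obtain c where "formal_solution n s j c" "c 0 = c0" "c j = d"
    by (auto simp: is_coeff_def)
  thus "d = (\<lambda>x. 1 / (\<Prod>i=1..j. indicial n s i) * (lapM n ^^ j) c0 x)"
    using formal_solution_coefficient [OF n _ nz order_refl] by metis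
next
  assume d: "d = (\<lambda>x. 1 / (\<Prod>i=1..j. indicial n s i) * (lapM n ^^ j) c0 x)"
  define c where "c k = (\<lambda>x. 1 / (\<Prod>i=1..k. indicial n s i) * (lapM n ^^ k) c0 x)" for k
  have "c k \<in> C_infty {1..n-1}" for k
    unfolding c_def by (intro C_infty_cmult C_infty_lapM_iterate n c0)
  moreover have "lapM n (c k) = (\<lambda>x. indicial n s (Suc k) * c (Suc k) x)" if "k < j" for k
  proof -
    have "indicial n s (Suc k) \<noteq> 0" using that nz by simp
    thus ?thesis
      unfolding c_def lapM_cmult [OF n C_infty_lapM_iterate [OF n c0]] by simp
  qed
  ultimately have "formal_solution n s j c" by (simp add: formal_solution_iff)
  moreover have "c 0 = c0" "c j = d" by (simp_all add: c_def d)
  ultimately show "is_coeff n j s c0 d" unfolding is_coeff_def by blast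
qed

lemma T_op_eq:
  assumes "2 \<le> n" "c0 \<in> C_infty {1..n-1}" "\<And>i. i \<in> {1..j} \<Longrightarrow> indicial n s i \<noteq> 0"
  shows "T_op n j s c0 x = 1 / (\<Prod>i=1..j. indicial n s i) * (lapM n ^^ j) c0 x"
proof -
  have "T_op n j s c0 = (\<lambda>x. 1 / (\<Prod>i=1..j. indicial n s i) * (lapM n ^^ j) c0 x)"
    unfolding T_op_def by (rule the_equality) (simp_all only: is_coeff_iff [OF assms])
  thus ?thesis by simp
qed

text \<open>
  At a zero of \<open>indicial\<close> in order \<open>j\<close>, the sequence whose only nonzero member is the constant \<open>1\<close>
  in position \<open>j\<close> solves all equations up to that order, as does the zero sequence: uniqueness
  fails.
\<close>

lemma determined_iff:
  assumes n: "2 \<le> n"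
  shows "determined n N s \<longleftrightarrow> (\<forall>i\<in>{1..N}. indicial n s i \<noteq> 0)"
proof
  assume det: "determined n N s"
  show "\<forall>i\<in>{1..N}. indicial n s i \<noteq> 0"
  proof (intro ballI notI)
    fix j assume j: "j \<in> {1..N}" and z: "indicial n s j = 0"
    define c :: "complex \<Rightarrow> nat \<Rightarrow> (nat \<Rightarrow> real) \<Rightarrow> complex"
      where "c a k = (\<lambda>_. if k = j then a else 0)" for a k
    have "formal_solution n s j (c a)" for a
      using z by (auto simp: formal_solution_iff c_def C_infty_const lapM_zero)
    moreover have "c a 0 = (\<lambda>_. 0)" "c a j = (\<lambda>_. a)" for a
      using j by (auto simp: c_def)
    ultimately have coeff: "is_coeff n j s (\<lambda>_. 0) (\<lambda>_. a)" for a
      unfolding is_coeff_def by blast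
    have "\<exists>!d. is_coeff n j s (\<lambda>_. 0) d"
      using det j C_infty_const unfolding determined_def atLeastAtMost_iff by blast
    hence "(\<lambda>_ :: nat \<Rightarrow> real. 0 :: complex) = (\<lambda>_. 1)" using coeff by blast
    thus False by (simp add: fun_eq_iff)
  qed
next
  assume "\<forall>i\<in>{1..N}. indicial n s i \<noteq> 0"
  hence "is_coeff n j s c0 d \<longleftrightarrow>
      d = (\<lambda>x. 1 / (\<Prod>i=1..j. indicial n s i) * (lapM n ^^ j) c0 x)"
    if "j \<le> N" "c0 \<in> C_infty {1..n-1}" for j c0 d
    using that by (intro is_coeff_iff n) auto
  thus "determined n N s" unfolding determined_def by (metis (no_types, lifting))
qed

section \<open>Comparison of the two families\<close>

lemma indicial_shift:
  "indicial n (lam + of_nat n - 1 - 2 * of_nat N) j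
     = - 2 * of_nat j * (of_nat n - 1 + 2 * lam - 4 * of_nat N + 2 * of_nat j)"
  by (simp add: indicial_def algebra_simps)

text \<open>
  Passing from \<open>j + 1\<close> to \<open>j\<close> multiplies the left side by
  \<open>\<theta>\<^sub>j\<^sub>+\<^sub>1 / ((2 N - 2 j) (2 N - 2 j - 1))\<close>, where \<open>\<theta>\<close> stands for \<open>indicial\<close> at the shifted
  parameter, and by \<open>a_coef_recurrence\<close> it does the same to the right side.  So the induction
  descends from \<open>j = N\<close>.
\<close>

lemma coefficient_ratio:
  assumes "j \<le> N"
    and nz: "\<And>i. i \<in> {1..N} \<Longrightarrow> indicial n (lam + of_nat n - 1 - 2 * of_nat N) i \<noteq> 0"
  shows "1 / (fact (2 * N - 2 * j) *
        (\<Prod>i=1..j. indicial n (lam + of_nat n - 1 - 2 * of_nat N) i))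
      = 1 / (\<Prod>i=1..N. indicial n (lam + of_nat n - 1 - 2 * of_nat N) i) * a_coef n N lam j"
  using assms(1)
proof (induction rule: inc_induct)
  case base
  show ?case by (simp add: a_coef_top)
next
  case (step j)
  let ?\<theta> = "indicial n (lam + of_nat n - 1 - 2 * of_nat N)"
  obtain k where N: "N = Suc (j + k)" using step.hyps less_iff_Suc_add by auto
  \<comment> \<open>\<open>2 * ?A\<close> is the quotient \<open>(2 N - 2 j)! / (2 N - 2 j - 2)!\<close>.\<close>
  let ?A = "of_nat (Suc k) * of_nat (2 * k + 1) :: complex"
  have A: "?A \<noteq> 0" by (simp only: mult_eq_0_iff of_nat_eq_0_iff) simp
  have "?A * a_coef n N lam j
      + of_nat (Suc j) * (of_nat n - 1 + 2 * lam - 4 * of_nat N + 2 * of_nat (Suc j))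
        * a_coef n N lam (Suc j) = 0"
    using a_coef_recurrence [of "Suc j" N n lam] by (simp add: N del: of_nat_Suc of_nat_add of_nat_mult)
  hence rec: "2 * ?A * a_coef n N lam j = ?\<theta> (Suc j) * a_coef n N lam (Suc j)"
    unfolding indicial_shift by (simp only: algebra_simps) algebra
  have F: "fact (2 * N - 2 * j) = 2 * ?A * (fact (2 * N - 2 * Suc j) :: complex)"
  proof -
    have "2 * N - 2 * j = Suc (Suc (2 * k))" "2 * N - 2 * Suc j = 2 * k" by (auto simp: N)
    thus ?thesis by (simp add: algebra_simps)
  qed
  have P: "(\<Prod>i=1..Suc j. ?\<theta> i) = (\<Prod>i=1..j. ?\<theta> i) * ?\<theta> (Suc j)" by simp
  have nzs: "?\<theta> (Suc j) \<noteq> 0" using nz step.hyps by simp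
  have "1 / (fact (2 * N - 2 * j) * (\<Prod>i=1..j. ?\<theta> i))
      = ?\<theta> (Suc j) / (2 * ?A) * (1 / (fact (2 * N - 2 * Suc j) * (\<Prod>i=1..Suc j. ?\<theta> i)))"
    unfolding F P using nzs by (simp del: of_nat_Suc of_nat_add of_nat_mult)
  also have "\<dots> = 1 / (\<Prod>i=1..N. ?\<theta> i) * (?\<theta> (Suc j) * a_coef n N lam (Suc j) / (2 * ?A))"
    unfolding step.IH by simp
  also have "?\<theta> (Suc j) * a_coef n N lam (Suc j) / (2 * ?A) = a_coef n N lam j"
    unfolding rec [symmetric] using A by (simp del: of_nat_Suc of_nat_add of_nat_mult)
  finally show ?case .
qed

theorem theorem4:
  fixes n N :: nat
  assumes "4 \<le> n"
  shows "\<exists>p q :: complex poly. p \<noteq> 0 \<and> q \<noteq> 0 \<and>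
    finite {lam. \<not> determined n N (lam + of_nat n - 1 - 2 * of_nat N)} \<and>
    (\<forall>lam. determined n N (lam + of_nat n - 1 - 2 * of_nat N) \<longrightarrow>
       poly q lam \<noteq> 0 \<and>
       (\<forall>\<phi>\<in>C_infty {1..n}. \<forall>x.
          S_op n N (lam + of_nat n - 1 - 2 * of_nat N) \<phi> x
            = poly p lam / poly q lam * D_nc n N lam \<phi> x))"
proof -
  have n: "2 \<le> n" using assms by simp
  let ?s = "\<lambda>lam :: complex. lam + of_nat n - 1 - 2 * of_nat N"
  define l :: "nat \<Rightarrow> complex poly" where
    "l i = smult (- 2 * of_nat i) [:of_nat n - 1 - 4 * of_nat N + 2 * of_nat i, 2:]" for i
  define q where "q = (\<Prod>i=1..N. l i)"
  have l: "poly (l i) lam = indicial n (?s lam) i" for i lam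
    unfolding indicial_shift l_def by (simp add: algebra_simps)
  have q: "poly q lam = (\<Prod>i=1..N. indicial n (?s lam) i)" for lam
    by (simp add: q_def poly_prod l)
  have q0: "q \<noteq> 0" by (auto simp: q_def l_def)
  have det: "determined n N (?s lam) \<longleftrightarrow> poly q lam \<noteq> 0" for lam
    by (simp add: determined_iff [OF n] q)
  have "S_op n N (?s lam) \<phi> x = poly 1 lam / poly q lam * D_nc n N lam \<phi> x"
    if "determined n N (?s lam)" and \<phi>: "\<phi> \<in> C_infty {1..n}" for lam \<phi> x
  proof -
    have nz: "indicial n (?s lam) i \<noteq> 0" if "i \<in> {1..N}" for i
      using \<open>determined n N (?s lam)\<close> that by (simp add: determined_iff [OF n])
    let ?f = "\<lambda>j. istar n ((pd n ^^ (2 * N - 2 * j)) \<phi>)"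
    have "1 / fact (2 * N - 2 * j) * T_op n j (?s lam) (?f j) x
        = 1 / poly q lam * (a_coef n N lam j * (lapM n ^^ j) (?f j) x)" if "j \<le> N" for j
    proof -
      have "?f j \<in> C_infty {1..n-1}"
        using n by (intro C_infty_istar C_infty_pd_iterate \<phi>) simp
      hence "T_op n j (?s lam) (?f j) x
          = 1 / (\<Prod>i=1..j. indicial n (?s lam) i) * (lapM n ^^ j) (?f j) x"
        using that by (intro T_op_eq n nz) auto
      hence "1 / fact (2 * N - 2 * j) * T_op n j (?s lam) (?f j) x
          = 1 / (fact (2 * N - 2 * j) * (\<Prod>i=1..j. indicial n (?s lam) i)) * (lapM n ^^ j) (?f j) x"
        by simp
      thus ?thesis by (simp only: coefficient_ratio [OF that nz] q mult.assoc)
    qed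
    thus ?thesis
      unfolding S_op_def D_nc_def sum_distrib_left poly_1 by (intro sum.cong) auto
  qed
  moreover have "finite {lam. \<not> determined n N (?s lam)}"
    using poly_roots_finite [OF q0] by (simp add: det)
  ultimately show ?thesis
    using q0 det by (intro exI [of _ 1] exI [of _ q]) auto
qed

end
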